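(* Let $g$ be square-integrable on $\Omega_\alpha\times\Omega_\gamma$ with singular system $\{(\sigma_r,u_r,v_r)\}$, where $r$ ranges over the indices with $\sigma_r>0$; suppose $\alpha\mapsto g(\alpha,\cdot)$ is continuous from $\Omega_\alpha$ into $\mathcal{H}_\gamma$, and take the continuous versions $u_r=\sigma_r^{-1}T_gv_r$. Then for all $\alpha_1,\alpha_2\in\Omega_\alpha$, $$\lVert\Phi(\alpha_1)-\Phi(\alpha_2)\rVert_{\mathcal{H}_\gamma}^2=\sum_{r\ge1}\sigma_r^2\lVert u_r(\alpha_1)-u_r(\alpha_2)\rVert^2.$$ Consequently the following are equivalent: (i) $\Phi:\Omega_\alpha\to\mathcal{H}_\gamma$ is injective; (ii) the full eigenfunction map $U_\infty$ is injective on $\Omega_\alpha$ (where $U_\infty=U_M$ when $\operatorname{rank}T_g=M<\infty$).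
   Context: $\Omega_\alpha\subseteq\mathbb{R}^{d_\alpha}$ and $\Omega_\gamma\subseteq\mathbb{R}^{d_\gamma}$ are the supports of probability measures $\pi_\alpha$ and $\pi_\gamma$ having Lebesgue densities bounded away from $0$ and $\infty$ on $\Omega_\alpha$, $\Omega_\gamma$; $g:\Omega_\alpha\times\Omega_\gamma\to\mathbb{R}^{d_G}$ is measurable, and square-integrable means $\int\int\lVert g\rVert^2d\pi_\gamma d\pi_\alpha<\infty$. $L^2_\pi(\Omega_\gamma)$ is scalar $L^2(\pi_\gamma)$; $\mathcal{H}_\gamma=L^2(\pi_\gamma;\mathbb{R}^{d_G})$ and $\mathcal{H}_\alpha=L^2(\pi_\alpha;\mathbb{R}^{d_G})$ with inner products summed over the $d_G$ components. $T_g:L^2_\pi(\Omega_\gamma)\to\mathcal{H}_\alpha$ is $(T_g\phi)(\alpha)=\int g(\alpha,\gamma)\phi(\gamma)d\pi_\gamma(\gamma)$, a Hilbert-Schmidt operator. A singular system consists of positive singular values $\sigma_1\ge\sigma_2\ge\cdots>0$ (with multiplicity), an orthonormal system $\{u_r\}\subset\mathcal{H}_\alpha$ ($\mathbb{R}^{d_G}$-valued) and an orthonormal system $\{v_r\}\subset L^2_\pi(\Omega_\gamma)$ (scalar) with $g(\alpha,\gamma)=\sum_r\sigma_ru_r(\alpha)v_r(\gamma)$ in $L^2(\pi_\alpha\otimes\pi_\gamma;\mathbb{R}^{d_G})$. The response map is $\Phi(\alpha)=g(\alpha,\cdot)\in\mathcal{H}_\gamma$, $U_M(\alpha)=(u_1(\alpha)^\top,\dots,u_M(\alpha)^\top)^\top$,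 and $U_\infty(\alpha)=\{u_r(\alpha)\}_{r\ge1}$. *)

theory Defs
  imports "HOL-Probability.Probability"
begin

definition measure_support :: "'a::topological_space measure \<Rightarrow> 'a set" where
  "measure_support M = {x. \<forall>U. open U \<longrightarrow> x \<in> U \<longrightarrow> 0 < emeasure M (U \<inter> space M)}"

(* A probability measure on a Euclidean space is represented by its restriction to its
   support \<Omega>, so that space P = \<Omega> and functions need only be measurable on \<Omega>. *)
definition support_prob_measure ::
    "'a::euclidean_space set \<Rightarrow> 'a measure \<Rightarrow> bool" where
  "support_prob_measure \<Omega> P \<longleftrightarrow>
     prob_space P \<and> measure_support P = \<Omega> \<and>
     (\<exists>p :: 'a \<Rightarrow> real. p \<in> borel_measurable borel \<and>
        (\<exists>c C. 0 < c \<and> (\<forall>x\<in>\<Omega>. c \<le> p x \<and> p x \<le> C)) \<and>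
        P = density (restrict_space lborel \<Omega>) (\<lambda>x. ennreal (p x)))"

definition L2 :: "'a measure \<Rightarrow> ('a \<Rightarrow> 'b::euclidean_space) set" where
  "L2 M = {f \<in> borel_measurable M. integrable M (\<lambda>x. (norm (f x))\<^sup>2)}"

definition L2_inner :: "'a measure \<Rightarrow> ('a \<Rightarrow> 'b::euclidean_space) \<Rightarrow> ('a \<Rightarrow> 'b) \<Rightarrow> real" where
  "L2_inner M f h = (LINT x|M. f x \<bullet> h x)"

definition L2_norm :: "'a measure \<Rightarrow> ('a \<Rightarrow> 'b::euclidean_space) \<Rightarrow> real" where
  "L2_norm M f = sqrt (LINT x|M. (norm (f x))\<^sup>2)"

(* The elements of the Hilbert space L\<^sup>2(M) are the classes of functions in L2 M
   modulo equality almost everywhere. *)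
definition L2_class :: "'a measure \<Rightarrow> ('a \<Rightarrow> 'b::euclidean_space) \<Rightarrow> ('a \<Rightarrow> 'b) set" where
  "L2_class M f = {h \<in> L2 M. AE x in M. h x = f x}"

definition L2_space :: "'a measure \<Rightarrow> ('a \<Rightarrow> 'b::euclidean_space) set set" where
  "L2_space M = L2_class M ` L2 M"

definition L2_dist ::
    "'a measure \<Rightarrow> ('a \<Rightarrow> 'b::euclidean_space) set \<Rightarrow> ('a \<Rightarrow> 'b) set \<Rightarrow> real" where
  "L2_dist M F G = L2_norm M (\<lambda>x. (SOME f. f \<in> F) x - (SOME h. h \<in> G) x)"

(* The choice of representatives in L2_dist is immaterial. *)
lemma L2_dist_class:
  assumes "f \<in> L2 M" and "h \<in> L2 M"
  shows "L2_dist M (L2_class M f) (L2_class M h) = L2_norm M (\<lambda>x. f x - h x)"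
proof -
  define f' where "f' = (SOME k. k \<in> L2_class M f)"
  define h' where "h' = (SOME k. k \<in> L2_class M h)"
  have "f \<in> L2_class M f" "h \<in> L2_class M h"
    using assms by (auto simp: L2_class_def)
  then have "f' \<in> L2_class M f" "h' \<in> L2_class M h"
    unfolding f'_def h'_def by (metis someI)+
  then have f': "f' \<in> borel_measurable M" "AE x in M. f' x = f x"
    and h': "h' \<in> borel_measurable M" "AE x in M. h' x = h x"
    by (auto simp: L2_class_def L2_def)
  have m: "f \<in> borel_measurable M" "h \<in> borel_measurable M"
    using assms by (auto simp: L2_def)
  have "(LINT x|M. (norm (f' x - h' x))\<^sup>2) = (LINT x|M. (norm (f x - h x))\<^sup>2)"
  proof (rule integral_cong_AE)
    show "AE x in M. (norm (f' x - h' x))\<^sup>2 = (norm (f x - h x))\<^sup>2"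
      using f'(2) h'(2) by eventually_elim simp
  qed (use f'(1) h'(1) m in measurable)
  then show ?thesis
    by (simp add: L2_dist_def L2_norm_def f'_def h'_def)
qed

definition L2_continuous_on ::
    "'c::topological_space set \<Rightarrow> 'a measure \<Rightarrow> ('c \<Rightarrow> ('a \<Rightarrow> 'b::euclidean_space) set) \<Rightarrow> bool" where
  "L2_continuous_on S M F \<longleftrightarrow>
     (\<forall>s\<in>S. F s \<in> L2_space M \<and> ((\<lambda>t. L2_dist M (F t) (F s)) \<longlongrightarrow> 0) (at s within S))"

definition L2_orthonormal ::
    "'a measure \<Rightarrow> 'i set \<Rightarrow> ('i \<Rightarrow> 'a \<Rightarrow> 'b::euclidean_space) \<Rightarrow> bool" where
  "L2_orthonormal M I e \<longleftrightarrow>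
     (\<forall>r\<in>I. e r \<in> L2 M) \<and> (\<forall>r\<in>I. \<forall>s\<in>I. L2_inner M (e r) (e s) = (if r = s then 1 else 0))"

(* The image in L\<^sup>2(M) of the subspace S of L2 M has dimension n. *)
definition L2_has_dim ::
    "'a measure \<Rightarrow> ('a \<Rightarrow> 'b::euclidean_space) set \<Rightarrow> nat \<Rightarrow> bool" where
  "L2_has_dim M S n \<longleftrightarrow>
     (\<exists>b. (\<forall>i<n. b i \<in> S) \<and>
        (\<forall>c. (AE x in M. (\<Sum>i<n. c i *\<^sub>R b i x) = 0) \<longrightarrow> (\<forall>i<n. c i = 0)) \<and>
        (\<forall>f\<in>S. \<exists>c. AE x in M. f x = (\<Sum>i<n. c i *\<^sub>R b i x)))"

definition integral_op ::
    "'c measure \<Rightarrow> ('a \<Rightarrow> 'c \<Rightarrow> 'b::euclidean_space) \<Rightarrow> ('c \<Rightarrow> real) \<Rightarrow> 'a \<Rightarrow> 'b" where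
  "integral_op Q g \<phi> a = (LINT c|Q. \<phi> c *\<^sub>R g a c)"

definition op_has_rank ::
    "'a measure \<Rightarrow> 'c measure \<Rightarrow> ('a \<Rightarrow> 'c \<Rightarrow> 'b::euclidean_space) \<Rightarrow> nat \<Rightarrow> bool" where
  "op_has_rank P Q g n \<longleftrightarrow> L2_has_dim P (integral_op Q g ` L2 Q) n"

(* Indices start at 1.  If there are only finitely many singular values, \<sigma> is continued
   by zeros, and u, v are unconstrained there. *)
definition sv_indices :: "(nat \<Rightarrow> real) \<Rightarrow> nat set" where
  "sv_indices \<sigma> = {r. 1 \<le> r \<and> 0 < \<sigma> r}"

definition singular_system ::
    "'a measure \<Rightarrow> 'c measure \<Rightarrow> ('a \<Rightarrow> 'c \<Rightarrow> 'b::euclidean_space) \<Rightarrow>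
     (nat \<Rightarrow> real) \<Rightarrow> (nat \<Rightarrow> 'a \<Rightarrow> 'b) \<Rightarrow> (nat \<Rightarrow> 'c \<Rightarrow> real) \<Rightarrow> bool" where
  "singular_system P Q g \<sigma> u v \<longleftrightarrow>
     (\<forall>r\<ge>1. 0 \<le> \<sigma> r \<and> \<sigma> (Suc r) \<le> \<sigma> r) \<and>
     L2_orthonormal P (sv_indices \<sigma>) u \<and>
     L2_orthonormal Q (sv_indices \<sigma>) v \<and>
     (\<lambda>n. L2_norm (P \<Otimes>\<^sub>M Q)
        (\<lambda>(a, c). g a c - (\<Sum>r\<in>sv_indices \<sigma> \<inter> {..n}. (\<sigma> r * v r c) *\<^sub>R u r a)))
       \<longlonglongrightarrow> 0"

definition response_map ::
    "'c measure \<Rightarrow> ('a \<Rightarrow> 'c \<Rightarrow> 'b::euclidean_space) \<Rightarrow> 'a \<Rightarrow> ('c \<Rightarrow> 'b) set" where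
  "response_map Q g a = L2_class Q (g a)"

(* The tuple of the values u r a, r \<in> I, as an extensional function on I. *)
definition eigen_map :: "nat set \<Rightarrow> (nat \<Rightarrow> 'a \<Rightarrow> 'b) \<Rightarrow> 'a \<Rightarrow> nat \<Rightarrow> 'b" where
  "eigen_map I u a = (\<lambda>r\<in>I. u r a)"

end

theory Submission
  imports Defs
begin

text \<open>
  The defect in Bessel's inequality for g(a, _) with respect to the first n functions v_r is the
  integral over c of the squared error of the truncated singular expansion at a. Its mean over a
  tends to 0, so near a given a, in a set of positive measure, there is a point b with small
  defect. The defect at a is at most twice the one at b plus twice the squared distance of the
  responses, hence tends to 0 at every point of the support and not only almost everywhere.
  By the parallelogram law it then tends to 0 for g(a1, _) - g(a2, _) too, which is Parseval's
  identity for that difference.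

  For the rank, the u_r lie in the range of the operator, and for finitely many singular values
  they span it; the two dimensions are compared by solving linear systems for the coefficients.
\<close>

section \<open>Square-integrable functions: products, sums and scalings\<close>

lemma L2_measurable [measurable_dest]: "f \<in> L2 M \<Longrightarrow> f \<in> borel_measurable M"
  by (simp add: L2_def)

lemma L2_integrable: "f \<in> L2 M \<Longrightarrow> integrable M (\<lambda>x. (norm (f x))\<^sup>2)"
  by (simp add: L2_def)

text \<open>The sum of the squared norms dominates the product of the norms. Values of the operator
  and Fourier coefficients are integrals of this form.\<close>

lemma integrable_scaleR_L2:
  fixes f :: "'a \<Rightarrow> 'b::euclidean_space"
  assumes [measurable]: "\<phi> \<in> L2 M" "f \<in> L2 M"
  shows "integrable M (\<lambda>x. \<phi> x *\<^sub>R f x)"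
proof (rule Bochner_Integration.integrable_bound)
  show "integrable M (\<lambda>x. (norm (\<phi> x))\<^sup>2 + (norm (f x))\<^sup>2)"
    using assms by (intro Bochner_Integration.integrable_add L2_integrable)
  show "AE x in M. norm (\<phi> x *\<^sub>R f x) \<le> norm ((norm (\<phi> x))\<^sup>2 + (norm (f x))\<^sup>2)"
  proof (rule AE_I2)
    fix x
    have "2 * (\<bar>\<phi> x\<bar> * norm (f x)) \<le> \<bar>\<phi> x\<bar>\<^sup>2 + (norm (f x))\<^sup>2"
      using sum_squares_bound[of "\<bar>\<phi> x\<bar>" "norm (f x)"] by simp
    moreover have "0 \<le> \<bar>\<phi> x\<bar> * norm (f x)"
      by simp
    ultimately have "\<bar>\<phi> x\<bar> * norm (f x) \<le> \<bar>\<phi> x\<bar>\<^sup>2 + (norm (f x))\<^sup>2"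
      by linarith
    then show "norm (\<phi> x *\<^sub>R f x) \<le> norm ((norm (\<phi> x))\<^sup>2 + (norm (f x))\<^sup>2)"
      by simp
  qed
qed measurable

lemma integrable_inner_L2:
  fixes f h :: "'a \<Rightarrow> 'b::euclidean_space"
  assumes [measurable]: "f \<in> L2 M" "h \<in> L2 M"
  shows "integrable M (\<lambda>x. f x \<bullet> h x)"
proof (rule Bochner_Integration.integrable_bound)
  show "integrable M (\<lambda>x. (norm (f x))\<^sup>2 + (norm (h x))\<^sup>2)"
    using assms by (intro Bochner_Integration.integrable_add L2_integrable)
  show "AE x in M. norm (f x \<bullet> h x) \<le> norm ((norm (f x))\<^sup>2 + (norm (h x))\<^sup>2)"
  proof (rule AE_I2)
    fix x
    have "2 * (norm (f x) * norm (h x)) \<le> (norm (f x))\<^sup>2 + (norm (h x))\<^sup>2"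
      using sum_squares_bound[of "norm (f x)" "norm (h x)"] by simp
    moreover have "\<bar>f x \<bullet> h x\<bar> \<le> norm (f x) * norm (h x)"
      by (rule Cauchy_Schwarz_ineq2)
    moreover have "0 \<le> norm (f x) * norm (h x)"
      by simp
    ultimately show "norm (f x \<bullet> h x) \<le> norm ((norm (f x))\<^sup>2 + (norm (h x))\<^sup>2)"
      by simp
  qed
qed measurable

lemma L2_scaleR: "f \<in> L2 M \<Longrightarrow> (\<lambda>x. c *\<^sub>R f x) \<in> L2 M"
  by (auto simp: L2_def power_mult_distrib)

lemma L2_scaleR_const:
  fixes w :: "'b::euclidean_space"
  assumes [measurable]: "\<phi> \<in> L2 M"
  shows "(\<lambda>x. \<phi> x *\<^sub>R w) \<in> L2 M"
  using L2_integrable[OF assms] by (auto simp: L2_def power_mult_distrib)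

lemma L2_add:
  fixes f h :: "'a \<Rightarrow> 'b::euclidean_space"
  assumes [measurable]: "f \<in> L2 M" "h \<in> L2 M"
  shows "(\<lambda>x. f x + h x) \<in> L2 M"
proof -
  have "integrable M (\<lambda>x. (norm (f x))\<^sup>2 + 2 * (f x \<bullet> h x) + (norm (h x))\<^sup>2)"
    using assms
    by (intro Bochner_Integration.integrable_add integrable_mult_right L2_integrable
        integrable_inner_L2)
  then show ?thesis
    by (simp add: L2_def power2_norm_eq_inner inner_add_left inner_add_right inner_commute
        algebra_simps)
qed

lemma L2_diff:
  fixes f h :: "'a \<Rightarrow> 'b::euclidean_space"
  assumes "f \<in> L2 M" "h \<in> L2 M"
  shows "(\<lambda>x. f x - h x) \<in> L2 M"
  using L2_add[OF assms(1) L2_scaleR[OF assms(2), of "-1"]] by simp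

lemma L2_sum:
  fixes f :: "'i \<Rightarrow> 'a \<Rightarrow> 'b::euclidean_space"
  assumes "\<And>i. i \<in> F \<Longrightarrow> f i \<in> L2 M"
  shows "(\<lambda>x. \<Sum>i\<in>F. f i x) \<in> L2 M"
  using assms
proof (induction F rule: infinite_finite_induct)
  case (insert i F)
  then show ?case
    by (simp add: L2_add)
qed (simp_all add: L2_def)

lemma L2_orthonormal_subset: "L2_orthonormal M I e \<Longrightarrow> J \<subseteq> I \<Longrightarrow> L2_orthonormal M J e"
  unfolding L2_orthonormal_def by blast

lemma L2_norm_power2: "(L2_norm M f)\<^sup>2 = (LINT x|M. (norm (f x))\<^sup>2)"
  by (simp add: L2_norm_def)

section \<open>The Bessel defect of a finite family\<close>

text \<open>The \<open>v r\<close> are scalar and \<open>f\<close> is vector-valued, so the Fourier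
  coefficients are vectors. For an orthonormal family this is the squared distance from
  \<open>f\<close> to the space of sums of \<open>v r c *\<^sub>R w r\<close> with arbitrary vectors
  \<open>w r\<close>.\<close>

definition bessel_defect ::
    "'c measure \<Rightarrow> ('i \<Rightarrow> 'c \<Rightarrow> real) \<Rightarrow> 'i set \<Rightarrow> ('c \<Rightarrow> 'b::euclidean_space) \<Rightarrow> real" where
  "bessel_defect Q v F f =
     (LINT c|Q. (norm (f c))\<^sup>2) - (\<Sum>r\<in>F. (norm (LINT c|Q. v r c *\<^sub>R f c))\<^sup>2)"

text \<open>When the squared residual is expanded, the cross term takes away the sum of the squared
  coefficients twice. Orthonormality reduces the double sum to its diagonal, which gives that sum
  back once.\<close>

lemma bessel_defect_eq:
  fixes f :: "'c \<Rightarrow> 'b::euclidean_space"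
  assumes v: "L2_orthonormal Q F v" and F: "finite F" and f: "f \<in> L2 Q"
  shows "(LINT c|Q. (norm (f c - (\<Sum>r\<in>F. v r c *\<^sub>R (LINT c|Q. v r c *\<^sub>R f c))))\<^sup>2) =
         bessel_defect Q v F f"
proof -
  define w where "w r = (LINT c|Q. v r c *\<^sub>R f c)" for r
  have vL2: "v r \<in> L2 Q" if "r \<in> F" for r
    using v that by (simp add: L2_orthonormal_def)
  have vv: "(LINT c|Q. v r c * v s c) = (if r = s then 1 else 0)" if "r \<in> F" "s \<in> F" for r s
    using v that by (simp add: L2_orthonormal_def L2_inner_def)
  have ivv: "integrable Q (\<lambda>c. v r c * v s c)" if "r \<in> F" "s \<in> F" for r s
    using integrable_inner_L2[OF vL2 vL2, OF that] by simp
  have ivf: "integrable Q (\<lambda>c. v r c *\<^sub>R f c)" if "r \<in> F" for r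
    using integrable_scaleR_L2[OF vL2 f, OF that] .
  have ivfw: "integrable Q (\<lambda>c. v r c * (f c \<bullet> w r))" if "r \<in> F" for r
    using integrable_inner_left[OF ivf[OF that], of "w r"] by simp
  have vfw: "(LINT c|Q. v r c * (f c \<bullet> w r)) = (norm (w r))\<^sup>2" if "r \<in> F" for r
    using integral_inner_left[OF ivf[OF that], of "w r"]
    by (simp add: w_def power2_norm_eq_inner)
  have pw: "(norm (f c - (\<Sum>r\<in>F. v r c *\<^sub>R w r)))\<^sup>2 =
      (norm (f c))\<^sup>2 - 2 * (\<Sum>r\<in>F. v r c * (f c \<bullet> w r)) +
      (\<Sum>r\<in>F. \<Sum>s\<in>F. (v r c * v s c) * (w r \<bullet> w s))" for c
  proof -
    let ?S = "\<Sum>r\<in>F. v r c *\<^sub>R w r"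
    have "(norm (f c - ?S))\<^sup>2 = (norm (f c))\<^sup>2 - 2 * (f c \<bullet> ?S) + ?S \<bullet> ?S"
      using dot_norm_neg[of "f c" ?S] by (simp add: power2_norm_eq_inner)
    moreover have "f c \<bullet> ?S = (\<Sum>r\<in>F. v r c * (f c \<bullet> w r))"
      by (simp add: inner_sum_right)
    moreover have "?S \<bullet> ?S = (\<Sum>r\<in>F. \<Sum>s\<in>F. (v r c * v s c) * (w r \<bullet> w s))"
      by (simp add: inner_sum_left inner_sum_right sum_distrib_left mult_ac inner_commute)
    ultimately show ?thesis
      by simp
  qed
  have i1: "integrable Q (\<lambda>c. \<Sum>r\<in>F. v r c * (f c \<bullet> w r))"
    by (intro Bochner_Integration.integrable_sum ivfw)
  have i2: "integrable Q (\<lambda>c. \<Sum>r\<in>F. \<Sum>s\<in>F. (v r c * v s c) * (w r \<bullet> w s))"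
    by (intro Bochner_Integration.integrable_sum integrable_mult_left ivv)
  have "(LINT c|Q. (\<Sum>r\<in>F. v r c * (f c \<bullet> w r))) = (\<Sum>r\<in>F. (LINT c|Q. v r c * (f c \<bullet> w r)))"
    by (rule Bochner_Integration.integral_sum) (rule ivfw)
  also have "\<dots> = (\<Sum>r\<in>F. (norm (w r))\<^sup>2)"
    by (intro sum.cong refl vfw)
  finally have e1: "(LINT c|Q. (\<Sum>r\<in>F. v r c * (f c \<bullet> w r))) = (\<Sum>r\<in>F. (norm (w r))\<^sup>2)" .
  have "(LINT c|Q. (\<Sum>r\<in>F. \<Sum>s\<in>F. (v r c * v s c) * (w r \<bullet> w s))) =
      (\<Sum>r\<in>F. (LINT c|Q. (\<Sum>s\<in>F. (v r c * v s c) * (w r \<bullet> w s))))"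
    by (intro Bochner_Integration.integral_sum Bochner_Integration.integrable_sum
        integrable_mult_left ivv)
  also have "\<dots> = (\<Sum>r\<in>F. \<Sum>s\<in>F. (LINT c|Q. (v r c * v s c) * (w r \<bullet> w s)))"
    by (intro sum.cong refl Bochner_Integration.integral_sum integrable_mult_left ivv)
  also have "\<dots> = (\<Sum>r\<in>F. \<Sum>s\<in>F. if r = s then w r \<bullet> w s else 0)"
    by (intro sum.cong refl) (simp only: integral_mult_left_zero vv, simp)
  also have "\<dots> = (\<Sum>r\<in>F. (norm (w r))\<^sup>2)"
    using F by (simp add: power2_norm_eq_inner)
  finally have e2: "(LINT c|Q. (\<Sum>r\<in>F. \<Sum>s\<in>F. (v r c * v s c) * (w r \<bullet> w s))) =
      (\<Sum>r\<in>F. (norm (w r))\<^sup>2)" .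
  have "(LINT c|Q. (norm (f c - (\<Sum>r\<in>F. v r c *\<^sub>R w r)))\<^sup>2) =
      (LINT c|Q. (norm (f c))\<^sup>2) - 2 * (LINT c|Q. (\<Sum>r\<in>F. v r c * (f c \<bullet> w r))) +
      (LINT c|Q. (\<Sum>r\<in>F. \<Sum>s\<in>F. (v r c * v s c) * (w r \<bullet> w s)))"
    unfolding pw
    using Bochner_Integration.integral_add[OF Bochner_Integration.integrable_diff[OF
          L2_integrable[OF f] integrable_mult_right[OF i1, of 2]] i2]
      Bochner_Integration.integral_diff[OF L2_integrable[OF f] integrable_mult_right[OF i1, of 2]]
    by (simp only: integral_mult_right_zero)
  also have "\<dots> = (LINT c|Q. (norm (f c))\<^sup>2) - (\<Sum>r\<in>F. (norm (w r))\<^sup>2)"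
    unfolding e1 e2 by linarith
  finally show ?thesis
    unfolding w_def bessel_defect_def .
qed

lemma bessel_defect_nonneg:
  assumes "L2_orthonormal Q F v" "finite F" "f \<in> L2 Q"
  shows "0 \<le> bessel_defect Q v F f"
  unfolding bessel_defect_eq[OF assms, symmetric] by simp

lemma bessel_defect_le: "bessel_defect Q v F f \<le> (L2_norm Q f)\<^sup>2"
  by (simp add: bessel_defect_def L2_norm_power2 sum_nonneg)

text \<open>The defect is a quadratic form: up to sign, each of its terms is the squared norm of a
  linear image of \<open>f\<close> and so inherits the parallelogram law.\<close>

lemma bessel_defect_parallelogram:
  fixes f h :: "'c \<Rightarrow> 'b::euclidean_space"
  assumes v: "\<And>r. r \<in> F \<Longrightarrow> v r \<in> L2 Q" and f: "f \<in> L2 Q" and h: "h \<in> L2 Q"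
  shows "bessel_defect Q v F (\<lambda>c. f c + h c) + bessel_defect Q v F (\<lambda>c. f c - h c) =
         2 * bessel_defect Q v F f + 2 * bessel_defect Q v F h"
proof -
  have par: "(norm (x + y))\<^sup>2 + (norm (x - y))\<^sup>2 = 2 * (norm x)\<^sup>2 + 2 * (norm y)\<^sup>2"
    for x y :: 'b
    by (simp add: power2_norm_eq_inner inner_add_left inner_add_right inner_diff_left
        inner_diff_right)
  have "(LINT c|Q. (norm (f c + h c))\<^sup>2) + (LINT c|Q. (norm (f c - h c))\<^sup>2) =
      (LINT c|Q. (norm (f c + h c))\<^sup>2 + (norm (f c - h c))\<^sup>2)"
    by (rule Bochner_Integration.integral_add[symmetric])
       (rule L2_integrable[OF L2_add[OF f h]], rule L2_integrable[OF L2_diff[OF f h]])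
  also have "\<dots> = 2 * (LINT c|Q. (norm (f c))\<^sup>2) + 2 * (LINT c|Q. (norm (h c))\<^sup>2)"
    unfolding par using L2_integrable[OF f] L2_integrable[OF h] by simp
  finally have 1: "(LINT c|Q. (norm (f c + h c))\<^sup>2) + (LINT c|Q. (norm (f c - h c))\<^sup>2) =
      2 * (LINT c|Q. (norm (f c))\<^sup>2) + 2 * (LINT c|Q. (norm (h c))\<^sup>2)" .
  have "(norm (LINT c|Q. v r c *\<^sub>R (f c + h c)))\<^sup>2 + (norm (LINT c|Q. v r c *\<^sub>R (f c - h c)))\<^sup>2 =
      2 * (norm (LINT c|Q. v r c *\<^sub>R f c))\<^sup>2 + 2 * (norm (LINT c|Q. v r c *\<^sub>R h c))\<^sup>2"
    if "r \<in> F" for r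
    unfolding scaleR_add_right scaleR_diff_right
      Bochner_Integration.integral_add[OF integrable_scaleR_L2[OF v[OF that] f]
        integrable_scaleR_L2[OF v[OF that] h]]
      Bochner_Integration.integral_diff[OF integrable_scaleR_L2[OF v[OF that] f]
        integrable_scaleR_L2[OF v[OF that] h]]
    by (rule par)
  then have "(\<Sum>r\<in>F. (norm (LINT c|Q. v r c *\<^sub>R (f c + h c)))\<^sup>2) +
      (\<Sum>r\<in>F. (norm (LINT c|Q. v r c *\<^sub>R (f c - h c)))\<^sup>2) =
      2 * (\<Sum>r\<in>F. (norm (LINT c|Q. v r c *\<^sub>R f c))\<^sup>2) +
      2 * (\<Sum>r\<in>F. (norm (LINT c|Q. v r c *\<^sub>R h c))\<^sup>2)"
    unfolding sum_distrib_left sum.distrib[symmetric] by (rule sum.cong[OF refl])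
  with 1 show ?thesis
    unfolding bessel_defect_def by (simp only: right_diff_distrib)
qed

lemma bessel_defect_add_le:
  fixes f h :: "'c \<Rightarrow> 'b::euclidean_space"
  assumes v: "L2_orthonormal Q F v" and F: "finite F" and f: "f \<in> L2 Q" and h: "h \<in> L2 Q"
  shows "bessel_defect Q v F (\<lambda>c. f c + h c) \<le> 2 * bessel_defect Q v F f + 2 * bessel_defect Q v F h"
    and "bessel_defect Q v F (\<lambda>c. f c - h c) \<le> 2 * bessel_defect Q v F f + 2 * bessel_defect Q v F h"
proof -
  have "v r \<in> L2 Q" if "r \<in> F" for r
    using v that by (simp add: L2_orthonormal_def)
  note eq = bessel_defect_parallelogram[where F = F and v = v, OF this f h]
  note nn = bessel_defect_nonneg[OF v F L2_add[OF f h]] bessel_defect_nonneg[OF v F L2_diff[OF f h]]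
  show "bessel_defect Q v F (\<lambda>c. f c + h c) \<le> 2 * bessel_defect Q v F f + 2 * bessel_defect Q v F h"
    using eq nn by linarith
  show "bessel_defect Q v F (\<lambda>c. f c - h c) \<le> 2 * bessel_defect Q v F f + 2 * bessel_defect Q v F h"
    using eq nn by linarith
qed

section \<open>Linear systems and the comparison of dimensions\<close>

text \<open>Gaussian elimination, one equation per induction step: a nonzero entry of row
  \<open>k\<close> serves as pivot to eliminate one unknown, and a zero row is satisfied by every
  \<open>c\<close>.\<close>

lemma homogeneous_system_nontrivial_solution:
  fixes A :: "'i \<Rightarrow> 'j \<Rightarrow> 'f::field"
  assumes "finite K" "finite J" "card K < card J"
  shows "\<exists>c. (\<exists>j\<in>J. c j \<noteq> 0) \<and> (\<forall>i\<in>K. (\<Sum>j\<in>J. c j * A i j) = 0)"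
  using assms
proof (induction K arbitrary: J A rule: finite_induct)
  case empty
  then have "J \<noteq> {}"
    by auto
  then show ?case
    by (intro exI[of _ "\<lambda>_. 1"]) auto
next
  case (insert k K)
  show ?case
  proof (cases "\<exists>p\<in>J. A k p \<noteq> 0")
    case False
    moreover obtain c where "\<exists>j\<in>J. c j \<noteq> 0" "\<forall>i\<in>K. (\<Sum>j\<in>J. c j * A i j) = 0"
      using insert.IH[of J A] insert.prems insert.hyps by auto
    ultimately show ?thesis
      by (intro exI[of _ c]) auto
  next
    case True
    then obtain p where p: "p \<in> J" "A k p \<noteq> 0"
      by blast
    have "card K < card (J - {p})"
      using insert.prems insert.hyps p by simp
    \<comment> \<open>Subtracting \<open>A i p / A k p\<close> times row \<open>k\<close> from row
      \<open>i\<close> removes the unknown \<open>p\<close>, which leaves one equation and one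
      unknown fewer.\<close>
    then obtain c where c: "\<exists>j\<in>J-{p}. c j \<noteq> 0"
      "\<And>i. i \<in> K \<Longrightarrow> (\<Sum>j\<in>J-{p}. c j * (A i j - A i p * A k j / A k p)) = 0"
      using insert.IH[of "J - {p}" "\<lambda>i j. A i j - A i p * A k j / A k p"] insert.prems by auto
    define s where "s = (\<Sum>j\<in>J-{p}. c j * A k j)"
    \<comment> \<open>The value at \<open>p\<close> is the one forced by the equation of row
      \<open>k\<close>.\<close>
    define c' where "c' = c(p := - s / A k p)"
    have split: "(\<Sum>j\<in>J. c' j * A i j) = - s / A k p * A i p + (\<Sum>j\<in>J-{p}. c j * A i j)" for i
      using insert.prems p by (simp add: sum.remove[of J p] c'_def)
    have "(\<Sum>j\<in>J. c' j * A i j) = 0" if "i \<in> insert k K" for i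
    proof (cases "i = k")
      case True
      then show ?thesis
        using p by (simp add: split s_def)
    next
      case False
      have "(\<Sum>j\<in>J-{p}. c j * (A i j - A i p * A k j / A k p)) =
          (\<Sum>j\<in>J-{p}. c j * A i j) - s / A k p * A i p"
        unfolding s_def
        by (simp add: sum_subtractf sum_distrib_left sum_distrib_right sum_divide_distrib
            algebra_simps)
      then show ?thesis
        using c(2)[of i] that False by (simp add: split)
    qed
    moreover have "\<exists>j\<in>J. c' j \<noteq> 0"
      using c(1) by (auto simp: c'_def)
    ultimately show ?thesis
      by blast
  qed
qed

text \<open>The exchange inequality modulo null sets: were \<open>J\<close> larger than
  \<open>K\<close>, some nontrivial combination of the \<open>y j\<close> would have all its
  coefficients in the \<open>x i\<close> equal to 0. As \<open>J\<close> is finite, the exceptional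
  sets lie in one null set.\<close>

lemma AE_independent_card_le:
  fixes x :: "'i \<Rightarrow> 'a \<Rightarrow> 'b::real_vector" and y :: "'j \<Rightarrow> 'a \<Rightarrow> 'b"
  assumes K: "finite K" and J: "finite J"
    and span: "\<And>j. j \<in> J \<Longrightarrow> AE t in M. y j t = (\<Sum>i\<in>K. A j i *\<^sub>R x i t)"
    and indep: "\<And>c j. (AE t in M. (\<Sum>j\<in>J. c j *\<^sub>R y j t) = 0) \<Longrightarrow> j \<in> J \<Longrightarrow> c j = 0"
  shows "card J \<le> card K"
proof (rule ccontr)
  assume "\<not> card J \<le> card K"
  then obtain c where c: "\<exists>j\<in>J. c j \<noteq> 0" "\<And>i. i \<in> K \<Longrightarrow> (\<Sum>j\<in>J. c j * A j i) = 0"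
    using homogeneous_system_nontrivial_solution[OF K J, of "\<lambda>i j. A j i"] by auto
  have "AE t in M. \<forall>j\<in>J. y j t = (\<Sum>i\<in>K. A j i *\<^sub>R x i t)"
    using span J by (simp add: AE_finite_all)
  then have "AE t in M. (\<Sum>j\<in>J. c j *\<^sub>R y j t) = 0"
  proof eventually_elim
    case (elim t)
    then have "(\<Sum>j\<in>J. c j *\<^sub>R y j t) = (\<Sum>j\<in>J. \<Sum>i\<in>K. (c j * A j i) *\<^sub>R x i t)"
      by (simp add: scaleR_sum_right)
    also have "\<dots> = (\<Sum>i\<in>K. (\<Sum>j\<in>J. c j * A j i) *\<^sub>R x i t)"
      by (subst sum.swap) (simp add: scaleR_sum_left)
    finally show ?case
      using c(2) by simp
  qed
  then show False
    using indep c(1) by blast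
qed

text \<open>The inner product of the vanishing combination with \<open>u s\<close> is
  \<open>c s\<close>.\<close>

lemma L2_orthonormal_independent:
  fixes u :: "'i \<Rightarrow> 'a \<Rightarrow> 'b::euclidean_space"
  assumes u: "L2_orthonormal M J u" and J: "finite J" "s \<in> J"
    and z: "AE t in M. (\<Sum>j\<in>J. c j *\<^sub>R u j t) = 0"
  shows "c s = 0"
proof -
  have i: "integrable M (\<lambda>t. u j t \<bullet> u s t)" if "j \<in> J" for j
    using u that J by (intro integrable_inner_L2) (auto simp: L2_orthonormal_def)
  have "(\<lambda>t. \<Sum>j\<in>J. c j *\<^sub>R u j t) \<in> L2 M" "u s \<in> L2 M"
    using u J by (auto intro!: L2_sum L2_scaleR simp: L2_orthonormal_def)
  then have [measurable]: "(\<lambda>t. \<Sum>j\<in>J. c j *\<^sub>R u j t) \<in> borel_measurable M"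
    "u s \<in> borel_measurable M"
    by (auto dest: L2_measurable)
  have "(LINT t|M. (\<Sum>j\<in>J. c j *\<^sub>R u j t) \<bullet> u s t) = (LINT t|M. 0)"
  proof (rule integral_cong_AE)
    show "AE t in M. (\<Sum>j\<in>J. c j *\<^sub>R u j t) \<bullet> u s t = 0"
      using z by eventually_elim simp
  qed measurable
  moreover have "(LINT t|M. (\<Sum>j\<in>J. c j *\<^sub>R u j t) \<bullet> u s t) =
      (\<Sum>j\<in>J. c j * (LINT t|M. u j t \<bullet> u s t))"
    using i by (simp add: inner_sum_left)
  moreover have "\<dots> = (\<Sum>j\<in>J. if j = s then c j else 0)"
    using u J by (intro sum.cong) (auto simp: L2_orthonormal_def L2_inner_def)
  ultimately show ?thesis
    using J by simp
qed

section \<open>From convergence in the mean to convergence at a point\<close>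

text \<open>The squared norm is a product of functions of one variable each, so Fubini applies. This
  puts the truncated singular expansions in L2 of the product measure.\<close>

lemma L2_prod_scaleR:
  fixes u :: "'a \<Rightarrow> 'b::euclidean_space"
  assumes P: "sigma_finite_measure P" and Q: "sigma_finite_measure Q"
    and u: "u \<in> L2 P" and v: "v \<in> L2 Q"
  shows "(\<lambda>(a, c). v c *\<^sub>R u a) \<in> L2 (P \<Otimes>\<^sub>M Q)"
proof -
  interpret pair_sigma_finite P Q
    using P Q by (simp add: pair_sigma_finite_def)
  note [measurable] = L2_measurable[OF u] L2_measurable[OF v]
  have vi: "integrable Q (\<lambda>c. (v c)\<^sup>2)" and ui: "integrable P (\<lambda>a. (norm (u a))\<^sup>2)"
    using L2_integrable[OF v] L2_integrable[OF u] by simp_all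
  have "integrable (P \<Otimes>\<^sub>M Q) (\<lambda>x. (v (snd x))\<^sup>2 * (norm (u (fst x)))\<^sup>2)"
  proof (rule Fubini_integrable)
    show "integrable P (\<lambda>a. LINT c|Q. norm ((v (snd (a, c)))\<^sup>2 * (norm (u (fst (a, c))))\<^sup>2))"
      using ui by simp
    show "AE a in P. integrable Q (\<lambda>c. (v (snd (a, c)))\<^sup>2 * (norm (u (fst (a, c))))\<^sup>2)"
      using vi by simp
  qed measurable
  moreover have "(\<lambda>(a, c). v c *\<^sub>R u a) \<in> borel_measurable (P \<Otimes>\<^sub>M Q)"
    by measurable
  ultimately show ?thesis
    by (simp add: L2_def case_prod_beta power_mult_distrib)
qed

text \<open>The singular system provides convergence in the norm of the product space.
  \<open>nbhd\<close>, which holds at points of the support, and \<open>cont\<close> carry it to the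
  single point \<open>a\<close>; \<open>coef\<close> fixes the versions of the \<open>u r\<close> at
  every point.\<close>

lemma bessel_defect_singular_system_tendsto_zero:
  fixes g :: "'a::topological_space \<Rightarrow> 'c \<Rightarrow> 'b::euclidean_space"
  assumes P: "prob_space P" and Q: "sigma_finite_measure Q"
    and g: "(\<lambda>(a, c). g a c) \<in> L2 (P \<Otimes>\<^sub>M Q)"
    and sec: "\<And>b. b \<in> space P \<Longrightarrow> g b \<in> L2 Q"
    and sys: "singular_system P Q g \<sigma> u v"
    and coef: "\<And>r b. r \<in> sv_indices \<sigma> \<Longrightarrow> b \<in> space P \<Longrightarrow> integral_op Q g (v r) b = \<sigma> r *\<^sub>R u r b"
    and a: "a \<in> space P"
    and nbhd: "\<And>U. open U \<Longrightarrow> a \<in> U \<Longrightarrow> U \<inter> space P \<in> sets P \<and> 0 < emeasure P (U \<inter> space P)"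
    and cont: "((\<lambda>b. L2_norm Q (\<lambda>c. g b c - g a c)) \<longlongrightarrow> 0) (at a within space P)"
  shows "(\<lambda>n. bessel_defect Q v (sv_indices \<sigma> \<inter> {..n}) (g a)) \<longlonglongrightarrow> 0"
proof -
  interpret P: prob_space P by fact
  interpret PQ: pair_sigma_finite P Q
    using Q by (simp add: pair_sigma_finite_def P.sigma_finite_measure_axioms)
  define F where "F n = sv_indices \<sigma> \<inter> {..n}" for n :: nat
  define D where "D n b = bessel_defect Q v (F n) (g b)" for n b
  define h where "h n = (\<lambda>(b, c). g b c - (\<Sum>r\<in>F n. (\<sigma> r * v r c) *\<^sub>R u r b))" for n
  have finF: "finite (F n)" for n
    by (simp add: F_def)
  have orthF: "L2_orthonormal Q (F n) v" for n
    using sys by (auto simp: singular_system_def L2_orthonormal_def F_def)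
  have D_nonneg: "0 \<le> D n b" if "b \<in> space P" for n b
    unfolding D_def by (rule bessel_defect_nonneg[OF orthF finF sec[OF that]])
  have hL2: "h n \<in> L2 (P \<Otimes>\<^sub>M Q)" for n
  proof -
    have "(\<lambda>x. \<Sum>r\<in>F n. \<sigma> r *\<^sub>R (case x of (b, c) \<Rightarrow> v r c *\<^sub>R u r b)) \<in> L2 (P \<Otimes>\<^sub>M Q)"
      using sys
      by (intro L2_sum L2_scaleR L2_prod_scaleR P.sigma_finite_measure_axioms Q)
         (auto simp: singular_system_def L2_orthonormal_def F_def)
    from L2_diff[OF g this] show ?thesis
      by (simp add: h_def case_prod_unfold)
  qed
  \<comment> \<open>By \<open>coef\<close> the slice at \<open>b\<close> of the truncated singular
    expansion is the Fourier expansion of \<open>g b\<close>, so the inner integral in Fubini is a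
    Bessel defect.\<close>
  have D_eq: "(LINT c|Q. (norm (h n (b, c)))\<^sup>2) = D n b" if b: "b \<in> space P" for n b
  proof -
    have "(\<Sum>r\<in>F n. (\<sigma> r * v r c) *\<^sub>R u r b) = (\<Sum>r\<in>F n. v r c *\<^sub>R (LINT c|Q. v r c *\<^sub>R g b c))" for c
      using coef[OF _ b] by (intro sum.cong) (auto simp: F_def integral_op_def mult.commute)
    then show ?thesis
      using bessel_defect_eq[OF orthF finF sec[OF b]] by (simp add: h_def D_def)
  qed
  have D_integrable: "integrable P (D n)" for n
    using PQ.integrable_fst'[OF L2_integrable[OF hL2[of n]]]
    by (rule Bochner_Integration.integrable_cong[THEN iffD1, rotated 2]) (simp_all add: D_eq)
  have "(LINT b|P. D n b) = (L2_norm (P \<Otimes>\<^sub>M Q) (h n))\<^sup>2" for n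
    unfolding L2_norm_power2 PQ.integral_fst'[OF L2_integrable[OF hL2], symmetric]
    by (rule Bochner_Integration.integral_cong) (simp_all add: D_eq)
  moreover have "(\<lambda>n. (L2_norm (P \<Otimes>\<^sub>M Q) (h n))\<^sup>2) \<longlonglongrightarrow> 0\<^sup>2"
    using sys unfolding singular_system_def h_def F_def by (intro tendsto_power) simp
  ultimately have D_mean: "(\<lambda>n. LINT b|P. D n b) \<longlonglongrightarrow> 0"
    by simp
  have "\<forall>\<^sub>F n in sequentially. D n a < e" if "0 < e" for e
  proof -
    have "((\<lambda>b. (L2_norm Q (\<lambda>c. g b c - g a c))\<^sup>2) \<longlongrightarrow> 0\<^sup>2) (at a within space P)"
      by (intro tendsto_power cont)
    \<comment> \<open>Two contributions below \<open>e / 4\<close>, each doubled by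
      \<open>bessel_defect_add_le\<close>, stay below \<open>e\<close> together.\<close>
    then have "\<forall>\<^sub>F b in at a within space P. (L2_norm Q (\<lambda>c. g b c - g a c))\<^sup>2 < e / 4"
      by (rule order_tendstoD(2)) (use \<open>0 < e\<close> in simp)
    then obtain U where U: "open U" "a \<in> U"
      and near: "\<And>b. b \<in> U \<Longrightarrow> b \<noteq> a \<Longrightarrow> b \<in> space P \<Longrightarrow> (L2_norm Q (\<lambda>c. g b c - g a c))\<^sup>2 < e / 4"
      unfolding eventually_at_topological by blast
    \<comment> \<open>The filter leaves out \<open>a\<close> itself, where the distance is
      0.\<close>
    have near': "(L2_norm Q (\<lambda>c. g b c - g a c))\<^sup>2 < e / 4" if "b \<in> U \<inter> space P" for b
      using near[of b] that \<open>0 < e\<close> by (cases "b = a") (auto simp: L2_norm_def)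
    have sets[measurable]: "U \<inter> space P \<in> sets P" and pos: "0 < measure P (U \<inter> space P)"
      using nbhd[OF U] by (auto simp: P.emeasure_eq_measure)
    \<comment> \<open>If the defect were at least \<open>e / 4\<close> on all of
      \<open>U \<inter> space P\<close>, its mean would reach this threshold. The point
      \<open>b\<close> found below may depend on \<open>n\<close>.\<close>
    have "\<forall>\<^sub>F n in sequentially. (LINT b|P. D n b) < e / 4 * measure P (U \<inter> space P)"
      using \<open>0 < e\<close> pos by (intro order_tendstoD(2)[OF D_mean]) simp
    then show ?thesis
    proof eventually_elim
      case (elim n)
      have "\<exists>b\<in>U \<inter> space P. D n b < e / 4"
      proof (rule ccontr)
        assume "\<not> ?thesis"
        then have "e / 4 * indicator (U \<inter> space P) b \<le> D n b" if "b \<in> space P" for b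
          using D_nonneg[OF that] that by (auto simp: indicator_def not_less)
        then have "(LINT b|P. e / 4 * indicator (U \<inter> space P) b) \<le> (LINT b|P. D n b)"
          by (intro integral_mono D_integrable integrable_mult_right)
             (auto simp: P.emeasure_eq_measure)
        with elim show False
          by simp
      qed
      then obtain b where b: "b \<in> U \<inter> space P" "D n b < e / 4"
        by blast
      then have gb: "g b \<in> L2 Q" and d: "(\<lambda>c. g b c - g a c) \<in> L2 Q"
        using sec a by (auto intro!: L2_diff)
      \<comment> \<open>Here \<open>g a\<close> is written as \<open>g b\<close> minus the
        difference \<open>g b - g a\<close>.\<close>
      have "D n a \<le> 2 * D n b + 2 * bessel_defect Q v (F n) (\<lambda>c. g b c - g a c)"
        using bessel_defect_add_le(2)[OF orthF finF gb d] by (simp add: D_def)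
      also have "\<dots> < e"
        using b near'[OF b(1)] bessel_defect_le[of Q v "F n" "\<lambda>c. g b c - g a c"] by linarith
      finally show ?case .
    qed
  qed
  then have "(\<lambda>n. D n a) \<longlonglongrightarrow> 0"
    using D_nonneg[OF a] by (auto simp: order_tendsto_iff intro: always_eventually less_le_trans)
  then show ?thesis
    by (simp add: D_def F_def)
qed

section \<open>Classes modulo null sets, and measures on their support\<close>

lemma L2_norm_eq_0_iff:
  fixes f :: "'a \<Rightarrow> 'b::euclidean_space"
  assumes "f \<in> L2 M"
  shows "L2_norm M f = 0 \<longleftrightarrow> (AE x in M. f x = 0)"
  using integral_nonneg_eq_0_iff_AE[OF L2_integrable[OF assms]] by (simp add: L2_norm_def)

lemma L2_class_cong:
  assumes "AE x in M. f x = h x"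
  shows "L2_class M f = L2_class M h"
proof -
  have "(AE x in M. k x = f x) \<longleftrightarrow> (AE x in M. k x = h x)" for k
    by (rule eventually_subst) (use assms in eventually_elim, simp)
  then show ?thesis
    by (simp add: L2_class_def)
qed

text \<open>A representative \<open>h\<close> belongs to its own class, hence to that of
  \<open>f\<close>, so both agree almost everywhere. Through this the continuity hypothesis, stated
  for classes, makes every section of \<open>g\<close> square-integrable; Fubini alone yields almost
  every section.\<close>

lemma L2_class_in_L2_spaceD:
  assumes "f \<in> borel_measurable M" and "L2_class M f \<in> L2_space M"
  shows "f \<in> L2 M"
proof -
  from assms(2) obtain h where h: "h \<in> L2 M" "L2_class M f = L2_class M h"
    by (auto simp: L2_space_def)
  then have "h \<in> L2_class M f"
    by (simp add: L2_class_def)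
  then have "AE x in M. h x = f x"
    by (simp add: L2_class_def)
  then have "AE x in M. (norm (h x))\<^sup>2 = (norm (f x))\<^sup>2"
    by eventually_elim simp
  then have "integrable M (\<lambda>x. (norm (f x))\<^sup>2)"
    using h(1) assms(1)
    by (intro Bochner_Integration.integrable_cong_AE_imp[OF L2_integrable[OF h(1)]]) auto
  then show ?thesis
    using assms(1) by (simp add: L2_def)
qed

text \<open>The measure lives on the trace sigma-algebra of \<open>\<Omega>\<close>, which contains
  the traces of open sets. Together with the definition of the support this yields condition
  \<open>nbhd\<close> at every point of \<open>\<Omega>\<close>.\<close>

lemma support_prob_measureD:
  assumes "support_prob_measure \<Omega> P"
  shows "prob_space P" and "space P = \<Omega>"
    and "open U \<Longrightarrow> U \<inter> \<Omega> \<in> sets P"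
    and "open U \<Longrightarrow> x \<in> U \<Longrightarrow> x \<in> \<Omega> \<Longrightarrow> 0 < emeasure P (U \<inter> \<Omega>)"
proof -
  from assms obtain p :: "'a \<Rightarrow> real"
    where p: "P = density (restrict_space lborel \<Omega>) (\<lambda>x. ennreal (p x))"
    by (auto simp: support_prob_measure_def)
  show "prob_space P"
    using assms by (simp add: support_prob_measure_def)
  show space: "space P = \<Omega>"
    by (simp add: p space_restrict_space)
  show "U \<inter> \<Omega> \<in> sets P" if "open U"
    unfolding p sets_density sets_restrict_space Int_commute[of U]
    by (rule imageI) (simp add: that)
  show "0 < emeasure P (U \<inter> \<Omega>)" if "open U" "x \<in> U" "x \<in> \<Omega>"
  proof -
    have "x \<in> measure_support P"
      using assms that by (simp add: support_prob_measure_def)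
    then show ?thesis
      using that by (simp add: measure_support_def space)
  qed
qed

section \<open>The rank and the number of singular values\<close>

text \<open>The two comparisons of dimension give only the cardinality \<open>M\<close>. That the
  indices are exactly the first \<open>M\<close> comes from \<sigma> being nonincreasing.\<close>

lemma op_has_rank_sv_indices:
  fixes g :: "'a \<Rightarrow> 'c \<Rightarrow> 'b::euclidean_space"
  assumes sys: "singular_system P Q g \<sigma> u v"
    and sec: "\<And>a. a \<in> space P \<Longrightarrow> g a \<in> L2 Q"
    and coef: "\<And>r a. r \<in> sv_indices \<sigma> \<Longrightarrow> a \<in> space P \<Longrightarrow> integral_op Q g (v r) a = \<sigma> r *\<^sub>R u r a"
    and lim: "\<And>a. a \<in> space P \<Longrightarrow>
      (\<lambda>n. bessel_defect Q v (sv_indices \<sigma> \<inter> {..n}) (g a)) \<longlonglongrightarrow> 0"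
    and rank: "op_has_rank P Q g M"
  shows "sv_indices \<sigma> = {1..M}"
proof -
  let ?I = "sv_indices \<sigma>"
  from rank obtain b
    where b: "\<forall>i<M. b i \<in> integral_op Q g ` L2 Q"
      "\<forall>c. (AE a in P. (\<Sum>i<M. c i *\<^sub>R b i a) = 0) \<longrightarrow> (\<forall>i<M. c i = 0)"
      "\<forall>f\<in>integral_op Q g ` L2 Q. \<exists>c. AE a in P. f a = (\<Sum>i<M. c i *\<^sub>R b i a)"
    unfolding op_has_rank_def L2_has_dim_def by (elim exE conjE) (rule that)
  have u: "L2_orthonormal P ?I u" and v: "L2_orthonormal Q ?I v"
    using sys by (simp_all add: singular_system_def)
  have vL2: "v r \<in> L2 Q" if "r \<in> ?I" for r
    using v that by (simp add: L2_orthonormal_def)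
  \<comment> \<open>On \<open>space P\<close>, \<open>u r\<close> is the image of \<open>v r\<close>
    divided by \<open>\<sigma> r\<close>, hence a combination of the basis \<open>b\<close> almost
    everywhere.\<close>
  have "\<exists>c. AE a in P. u r a = (\<Sum>i<M. c i *\<^sub>R b i a)" if r: "r \<in> ?I" for r
  proof -
    have "integral_op Q g (\<lambda>c. (1 / \<sigma> r) *\<^sub>R v r c) a = u r a" if "a \<in> space P" for a
    proof -
      have "integral_op Q g (\<lambda>c. (1 / \<sigma> r) *\<^sub>R v r c) a = (LINT c|Q. (1 / \<sigma> r) *\<^sub>R (v r c *\<^sub>R g a c))"
        by (simp add: integral_op_def)
      also have "\<dots> = (1 / \<sigma> r) *\<^sub>R integral_op Q g (v r) a"
        unfolding integral_op_def by (rule integral_scaleR_right)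
      finally show ?thesis
        using r coef[OF r that] by (simp add: sv_indices_def)
    qed
    moreover obtain c
      where "AE a in P. integral_op Q g (\<lambda>c. (1 / \<sigma> r) *\<^sub>R v r c) a = (\<Sum>i<M. c i *\<^sub>R b i a)"
      using b(3) L2_scaleR[OF vL2[OF r]] by blast
    ultimately have "AE a in P. u r a = (\<Sum>i<M. c i *\<^sub>R b i a)"
      by (auto elim: AE_mp intro!: AE_I2)
    then show ?thesis
      by (rule exI[of _ c])
  qed
  then obtain A where A: "\<And>r. r \<in> ?I \<Longrightarrow> AE a in P. u r a = (\<Sum>i<M. A r i *\<^sub>R b i a)"
    by metis
  \<comment> \<open>Finite subsets are used because finiteness of the whole index set is deduced
    from this bound.\<close>
  have le: "card J \<le> M" if "J \<subseteq> ?I" "finite J" for J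
  proof -
    have "L2_orthonormal P J u"
      by (rule L2_orthonormal_subset[OF u that(1)])
    then have "card J \<le> card {..<M}"
      using that A
      by (intro AE_independent_card_le[where M = P and x = b and y = u and A = A])
         (auto dest: L2_orthonormal_independent)
    then show ?thesis
      by simp
  qed
  have fin: "finite ?I"
  proof (rule ccontr)
    assume "infinite ?I"
    then obtain J where "finite J" "card J = Suc M" "J \<subseteq> ?I"
      using infinite_arbitrarily_large by blast
    then show False
      using le[of J] by simp
  qed
  have expand: "integral_op Q g \<phi> a = (\<Sum>r\<in>?I. ((LINT c|Q. \<phi> c * v r c) * \<sigma> r) *\<^sub>R u r a)"
    if \<phi>: "\<phi> \<in> L2 Q" and a: "a \<in> space P" for \<phi> a
  proof -
    let ?R = "\<lambda>c. \<Sum>r\<in>?I. v r c *\<^sub>R (LINT c|Q. v r c *\<^sub>R g a c)"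
    \<comment> \<open>From \<open>N\<close> on truncation has no effect, so the limit 0 is the value
      of the full defect, and the finite expansion of \<open>g a\<close> is exact almost
      everywhere.\<close>
    obtain N where "?I \<subseteq> {..N}"
      using fin finite_nat_iff_bounded_le by blast
    then have "bessel_defect Q v (?I \<inter> {..n}) (g a) = bessel_defect Q v ?I (g a)" if "n \<ge> N" for n
      using that by (intro arg_cong[where f = "\<lambda>F. bessel_defect Q v F (g a)"]) auto
    then have "(\<lambda>n. bessel_defect Q v (?I \<inter> {..n}) (g a)) \<longlonglongrightarrow> bessel_defect Q v ?I (g a)"
      by (intro tendsto_eventually) (auto simp: eventually_at_top_linorder)
    then have "bessel_defect Q v ?I (g a) = 0"
      using lim[OF a] LIMSEQ_unique by blast
    then have "L2_norm Q (\<lambda>c. g a c - ?R c) = 0"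
      using bessel_defect_eq[OF v fin sec[OF a]] by (simp add: L2_norm_def)
    moreover have R: "?R \<in> L2 Q"
      by (intro L2_sum L2_scaleR_const vL2)
    ultimately have eq: "AE c in Q. g a c = ?R c"
      using L2_norm_eq_0_iff[OF L2_diff[OF sec[OF a] R]] by simp
    have "integral_op Q g \<phi> a = (LINT c|Q. \<phi> c *\<^sub>R ?R c)"
      unfolding integral_op_def
    proof (rule integral_cong_AE)
      show "AE c in Q. \<phi> c *\<^sub>R g a c = \<phi> c *\<^sub>R ?R c"
        using eq by eventually_elim simp
    qed (use integrable_scaleR_L2[OF \<phi> sec[OF a]] integrable_scaleR_L2[OF \<phi> R] in auto)
    also have "\<dots> = (LINT c|Q. (\<Sum>r\<in>?I. (\<phi> c * v r c) *\<^sub>R (\<sigma> r *\<^sub>R u r a)))"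
      using coef[OF _ a] by (simp add: scaleR_sum_right integral_op_def mult.assoc)
    also have "\<dots> = (\<Sum>r\<in>?I. (LINT c|Q. (\<phi> c * v r c) *\<^sub>R (\<sigma> r *\<^sub>R u r a)))"
      using integrable_scaleR_L2[OF \<phi> vL2]
      by (intro Bochner_Integration.integral_sum integrable_scaleR_left) simp
    also have "\<dots> = (\<Sum>r\<in>?I. ((LINT c|Q. \<phi> c * v r c) * \<sigma> r) *\<^sub>R u r a)"
      using integrable_scaleR_L2[OF \<phi> vL2]
      by (intro sum.cong refl) (subst integral_scaleR_left, simp_all)
    finally show ?thesis .
  qed
  \<comment> \<open>By \<open>expand\<close>, applied to preimages of the basis, each
    \<open>b i\<close> is a combination of the \<open>u r\<close>; this gives the reverse
    inequality.\<close>
  from b(1) obtain \<phi> where \<phi>: "\<And>i. i < M \<Longrightarrow> \<phi> i \<in> L2 Q" "\<And>i. i < M \<Longrightarrow> b i = integral_op Q g (\<phi> i)"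
    unfolding image_iff by metis
  have "card {..<M} \<le> card ?I"
  proof (rule AE_independent_card_le[OF fin])
    show "AE a in P. b i a = (\<Sum>r\<in>?I. ((LINT c|Q. \<phi> i c * v r c) * \<sigma> r) *\<^sub>R u r a)"
      if "i \<in> {..<M}" for i
      using \<phi> expand that by (intro AE_I2) simp
  qed (use b(2) in auto)
  then have card: "card ?I = M"
    using le[OF order_refl fin] by simp
  have down: "s \<in> ?I" if "r \<in> ?I" "1 \<le> s" "s \<le> r" for r s
  proof -
    have "\<sigma> r \<le> \<sigma> s"
      using \<open>s \<le> r\<close>
    proof (induction r rule: dec_induct)
      case (step n)
      then have "\<sigma> (Suc n) \<le> \<sigma> n"
        using sys \<open>1 \<le> s\<close> by (simp add: singular_system_def)
      with step show ?case
        by simp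
    qed simp
    then show ?thesis
      using that by (simp add: sv_indices_def)
  qed
  show ?thesis
  proof (cases "?I = {}")
    case True
    then show ?thesis
      using card by simp
  next
    case False
    \<comment> \<open>The index set contains every positive integer up to its maximum; its
      cardinality then identifies the maximum as \<open>M\<close>.\<close>
    have "?I = {1..Max ?I}"
      using down[OF Max_in[OF fin False]] fin by (auto simp: sv_indices_def)
    then show ?thesis
      using card by (metis card_atLeastAtMost diff_Suc_1 Suc_eq_plus1)
  qed
qed

section \<open>The distance formula and the two injectivities\<close>

theorem proposition1:
  fixes \<Omega>\<^sub>\<alpha> :: "(real ^ 'a) set" and \<Omega>\<^sub>\<gamma> :: "(real ^ 'c) set"
    and \<pi>\<^sub>\<alpha> :: "(real ^ 'a) measure" and \<pi>\<^sub>\<gamma> :: "(real ^ 'c) measure"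
    and g :: "real ^ 'a \<Rightarrow> real ^ 'c \<Rightarrow> real ^ 'g"
    and \<sigma> :: "nat \<Rightarrow> real"
    and u :: "nat \<Rightarrow> real ^ 'a \<Rightarrow> real ^ 'g"
    and v :: "nat \<Rightarrow> real ^ 'c \<Rightarrow> real"
  assumes "support_prob_measure \<Omega>\<^sub>\<alpha> \<pi>\<^sub>\<alpha>"
    and "support_prob_measure \<Omega>\<^sub>\<gamma> \<pi>\<^sub>\<gamma>"
    and "(\<lambda>(a, c). g a c) \<in> L2 (\<pi>\<^sub>\<alpha> \<Otimes>\<^sub>M \<pi>\<^sub>\<gamma>)"
    and "singular_system \<pi>\<^sub>\<alpha> \<pi>\<^sub>\<gamma> g \<sigma> u v"
    and "L2_continuous_on \<Omega>\<^sub>\<alpha> \<pi>\<^sub>\<gamma> (response_map \<pi>\<^sub>\<gamma> g)"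
    and "\<forall>r\<in>sv_indices \<sigma>. \<forall>a\<in>\<Omega>\<^sub>\<alpha>. u r a = (1 / \<sigma> r) *\<^sub>R integral_op \<pi>\<^sub>\<gamma> g (v r) a"
  shows "(\<forall>a1\<in>\<Omega>\<^sub>\<alpha>. \<forall>a2\<in>\<Omega>\<^sub>\<alpha>.
            ((\<lambda>r. (\<sigma> r)\<^sup>2 * (norm (u r a1 - u r a2))\<^sup>2) has_sum
               (L2_dist \<pi>\<^sub>\<gamma> (response_map \<pi>\<^sub>\<gamma> g a1) (response_map \<pi>\<^sub>\<gamma> g a2))\<^sup>2) (sv_indices \<sigma>)) \<and>
         (inj_on (response_map \<pi>\<^sub>\<gamma> g) \<Omega>\<^sub>\<alpha> \<longleftrightarrow> inj_on (eigen_map (sv_indices \<sigma>) u) \<Omega>\<^sub>\<alpha>) \<and>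
         (\<forall>M. op_has_rank \<pi>\<^sub>\<alpha> \<pi>\<^sub>\<gamma> g M \<longrightarrow>
            (\<forall>a\<in>\<Omega>\<^sub>\<alpha>. eigen_map (sv_indices \<sigma>) u a = eigen_map {1..M} u a))"
proof -
  note \<alpha> = support_prob_measureD[OF assms(1)]
  note \<gamma> = support_prob_measureD[OF assms(2)]
  note sys = assms(4)
  let ?I = "sv_indices \<sigma>" and ?\<Phi> = "response_map \<pi>\<^sub>\<gamma> g"
  have sec: "g a \<in> L2 \<pi>\<^sub>\<gamma>" if "a \<in> \<Omega>\<^sub>\<alpha>" for a
  proof (rule L2_class_in_L2_spaceD)
    show "g a \<in> borel_measurable \<pi>\<^sub>\<gamma>"
      using measurable_Pair2[OF L2_measurable[OF assms(3)], of a] that by (simp add: \<alpha>)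
    show "L2_class \<pi>\<^sub>\<gamma> (g a) \<in> L2_space \<pi>\<^sub>\<gamma>"
      using assms(5) that by (simp add: L2_continuous_on_def response_map_def)
  qed
  have dist: "L2_dist \<pi>\<^sub>\<gamma> (?\<Phi> a) (?\<Phi> b) = L2_norm \<pi>\<^sub>\<gamma> (\<lambda>c. g a c - g b c)"
    if "a \<in> \<Omega>\<^sub>\<alpha>" "b \<in> \<Omega>\<^sub>\<alpha>" for a b
    using L2_dist_class[OF sec sec, OF that] by (simp add: response_map_def)
  have coef: "integral_op \<pi>\<^sub>\<gamma> g (v r) a = \<sigma> r *\<^sub>R u r a" if "r \<in> ?I" "a \<in> \<Omega>\<^sub>\<alpha>" for r a
    using assms(6) that by (simp add: sv_indices_def)
  have v: "L2_orthonormal \<pi>\<^sub>\<gamma> ?I v"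
    using sys by (simp add: singular_system_def)
  then have vL2: "v r \<in> L2 \<pi>\<^sub>\<gamma>" if "r \<in> ?I" for r
    using that by (simp add: L2_orthonormal_def)
  have vn: "L2_orthonormal \<pi>\<^sub>\<gamma> (?I \<inter> {..n}) v" for n
    by (rule L2_orthonormal_subset[OF v]) simp
  have lim: "(\<lambda>n. bessel_defect \<pi>\<^sub>\<gamma> v (?I \<inter> {..n}) (g a)) \<longlonglongrightarrow> 0" if a: "a \<in> \<Omega>\<^sub>\<alpha>" for a
  proof (rule bessel_defect_singular_system_tendsto_zero[OF \<alpha>(1) _ assms(3) _ sys])
    show "sigma_finite_measure \<pi>\<^sub>\<gamma>"
      using \<gamma>(1) by (simp add: prob_space_imp_sigma_finite)
    have "((\<lambda>b. L2_dist \<pi>\<^sub>\<gamma> (?\<Phi> b) (?\<Phi> a)) \<longlongrightarrow> 0) (at a within \<Omega>\<^sub>\<alpha>)"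
      using assms(5) a by (simp add: L2_continuous_on_def)
    \<comment> \<open>The filter only sees points of \<open>\<Omega>\<^sub>\<alpha>\<close>, where
      the distance of classes can be computed from the sections of \<open>g\<close>.\<close>
    moreover have "\<forall>\<^sub>F b in at a within \<Omega>\<^sub>\<alpha>. L2_dist \<pi>\<^sub>\<gamma> (?\<Phi> b) (?\<Phi> a) = L2_norm \<pi>\<^sub>\<gamma> (\<lambda>c. g b c - g a c)"
      using dist a by (simp add: eventually_at_filter)
    ultimately show "((\<lambda>b. L2_norm \<pi>\<^sub>\<gamma> (\<lambda>c. g b c - g a c)) \<longlongrightarrow> 0) (at a within space \<pi>\<^sub>\<alpha>)"
      unfolding \<alpha>(2) by (rule Lim_transform_eventually)
  qed (use sec coef a \<alpha> in auto)
  have sum: "((\<lambda>r. (\<sigma> r)\<^sup>2 * (norm (u r a1 - u r a2))\<^sup>2) has_sum (L2_dist \<pi>\<^sub>\<gamma> (?\<Phi> a1) (?\<Phi> a2))\<^sup>2) ?I"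
    if a: "a1 \<in> \<Omega>\<^sub>\<alpha>" "a2 \<in> \<Omega>\<^sub>\<alpha>" for a1 a2
  proof -
    let ?f = "\<lambda>c. g a1 c - g a2 c" and ?t = "\<lambda>r. (\<sigma> r)\<^sup>2 * (norm (u r a1 - u r a2))\<^sup>2"
    let ?d = "\<lambda>n. bessel_defect \<pi>\<^sub>\<gamma> v (?I \<inter> {..n})"
    \<comment> \<open>The defects of the two responses control that of their difference, so its
      Bessel inequality becomes an equality in the limit.\<close>
    have "?d n ?f \<le> 2 * ?d n (g a1) + 2 * ?d n (g a2)" for n
      by (rule bessel_defect_add_le(2)[OF vn _ sec[OF a(1)] sec[OF a(2)]]) simp
    moreover have "0 \<le> ?d n ?f" for n
      by (rule bessel_defect_nonneg[OF vn _ L2_diff[OF sec[OF a(1)] sec[OF a(2)]]]) simp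
    moreover have "(\<lambda>n. 2 * ?d n (g a1) + 2 * ?d n (g a2)) \<longlonglongrightarrow> 2 * 0 + 2 * 0"
      by (intro tendsto_intros lim a)
    ultimately have "(\<lambda>n. ?d n ?f) \<longlonglongrightarrow> 0"
      by (intro tendsto_sandwich[of "\<lambda>_. 0" "\<lambda>n. ?d n ?f" sequentially]) auto
    then have "(\<lambda>n. (L2_norm \<pi>\<^sub>\<gamma> ?f)\<^sup>2 - ?d n ?f) \<longlonglongrightarrow> (L2_norm \<pi>\<^sub>\<gamma> ?f)\<^sup>2 - 0"
      by (intro tendsto_intros)
    moreover have "(norm (LINT c|\<pi>\<^sub>\<gamma>. v r c *\<^sub>R ?f c))\<^sup>2 = ?t r" if r: "r \<in> ?I" for r
    proof -
      have "(LINT c|\<pi>\<^sub>\<gamma>. v r c *\<^sub>R ?f c) = integral_op \<pi>\<^sub>\<gamma> g (v r) a1 - integral_op \<pi>\<^sub>\<gamma> g (v r) a2"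
        unfolding integral_op_def scaleR_diff_right
        by (rule Bochner_Integration.integral_diff; intro integrable_scaleR_L2 vL2 r sec a)
      also have "\<dots> = \<sigma> r *\<^sub>R (u r a1 - u r a2)"
        using coef[OF r] a by (simp add: scaleR_diff_right)
      finally show ?thesis
        by (simp add: power_mult_distrib)
    qed
    ultimately have "(\<lambda>n. \<Sum>r\<in>?I \<inter> {..n}. ?t r) \<longlonglongrightarrow> (L2_norm \<pi>\<^sub>\<gamma> ?f)\<^sup>2"
      by (simp add: bessel_defect_def L2_norm_power2)
    \<comment> \<open>Indices outside \<open>?I\<close> contribute 0, so the partial sums become
      those of a series over the naturals; nonnegative terms allow the passage to an unordered
      sum.\<close>
    then have "(\<lambda>r. if r \<in> ?I then ?t r else 0) sums (L2_norm \<pi>\<^sub>\<gamma> ?f)\<^sup>2"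
      by (simp add: sums_def_le sum.inter_restrict[symmetric] Int_commute)
    then have "((\<lambda>r. if r \<in> ?I then ?t r else 0) has_sum (L2_norm \<pi>\<^sub>\<gamma> ?f)\<^sup>2) UNIV"
      by (rule sums_nonneg_imp_has_sum) simp
    then have "(?t has_sum (L2_norm \<pi>\<^sub>\<gamma> ?f)\<^sup>2) ?I"
      by (rule has_sum_cong_neutral[THEN iffD1, rotated -1]) auto
    then show ?thesis
      by (simp only: dist[OF a])
  qed
  \<comment> \<open>Both maps identify the same pairs of points, from which the equivalence of the
    injectivities is immediate.\<close>
  have "?\<Phi> a1 = ?\<Phi> a2 \<longleftrightarrow> eigen_map ?I u a1 = eigen_map ?I u a2"
    if a: "a1 \<in> \<Omega>\<^sub>\<alpha>" "a2 \<in> \<Omega>\<^sub>\<alpha>" for a1 a2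
  proof
    assume "?\<Phi> a1 = ?\<Phi> a2"
    then have "L2_dist \<pi>\<^sub>\<gamma> (?\<Phi> a1) (?\<Phi> a2) = 0"
      by (simp add: L2_dist_def L2_norm_def)
    \<comment> \<open>Nonnegative terms with sum 0 all vanish; positivity of
      \<open>\<sigma> r\<close> then gives equality of the eigenfunction values.\<close>
    then have "(\<sigma> r)\<^sup>2 * (norm (u r a1 - u r a2))\<^sup>2 = 0" if "r \<in> ?I" for r
      using nonneg_has_sum_le_0D[OF sum[OF a] _ _ that] by simp
    then show "eigen_map ?I u a1 = eigen_map ?I u a2"
      unfolding eigen_map_def by (intro restrict_ext) (auto simp: sv_indices_def)
  next
    assume "eigen_map ?I u a1 = eigen_map ?I u a2"
    then have "u r a1 = u r a2" if "r \<in> ?I" for r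
      using that unfolding eigen_map_def by (metis restrict_apply')
    then have "((\<lambda>r. (\<sigma> r)\<^sup>2 * (norm (u r a1 - u r a2))\<^sup>2) has_sum 0) ?I"
      by (intro has_sum_0) simp
    then have "L2_norm \<pi>\<^sub>\<gamma> (\<lambda>c. g a1 c - g a2 c) = 0"
      using has_sum_unique[OF sum[OF a], of 0] dist[OF a] by simp
    \<comment> \<open>Norm 0 means equality almost everywhere, which is precisely equality of the
      classes.\<close>
    then have "AE c in \<pi>\<^sub>\<gamma>. g a1 c = g a2 c"
      using L2_norm_eq_0_iff[OF L2_diff[OF sec sec, OF a]] by simp
    then show "?\<Phi> a1 = ?\<Phi> a2"
      unfolding response_map_def by (rule L2_class_cong)
  qed
  then have "inj_on ?\<Phi> \<Omega>\<^sub>\<alpha> \<longleftrightarrow> inj_on (eigen_map ?I u) \<Omega>\<^sub>\<alpha>"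
    by (simp add: inj_on_def)
  moreover have "?I = {1..M}" if "op_has_rank \<pi>\<^sub>\<alpha> \<pi>\<^sub>\<gamma> g M" for M
    by (rule op_has_rank_sv_indices[OF sys _ _ _ that]) (use sec coef lim \<alpha> in auto)
  ultimately show ?thesis
    using sum by auto
qed

end
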